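(* Let $\Lambda$ be a proper $\Lambda$-sequence and let $f:[0,1]\to\mathbb{R}$. Then $\|B_nf-f\|_\Lambda\to 0$ as $n\to\infty$ if and only if $f\in C\Lambda BV_c$.
   Context: A $\Lambda$-sequence is a nondecreasing sequence $\Lambda=(\lambda_k)_{k\ge 1}$ of positive reals with $\sum_k \frac{1}{\lambda_k}=\infty$; it is proper if $\lambda_k\to\infty$. For a closed interval $I=[a,b]\subseteq[0,1]$ and $f:[0,1]\to\mathbb{R}$ write $|f(I)|=|f(b)-f(a)|$. Closed intervals are nonoverlapping if any two of them intersect at most at endpoints. For a finite sequence $\mathcal{I}=\langle I_1,\dots,I_m\rangle$ (in any order) of nonoverlapping closed intervals contained in $[0,1]$ put $\sigma_\Lambda(f,\mathcal{I})=\sum_{k=1}^m\frac{|f(I_k)|}{\lambda_k}$. The $\Lambda$-variation of $f$ is $V_\Lambda(f)=\sup_{\mathcal{I}}\sigma_\Lambda(f,\mathcal{I})\in[0,\infty]$, the supremum being over all such finite sequences. $\Lambda BV$ is the set of all $f:[0,1]\to\mathbb{R}$ with $V_\Lambda(f)<\infty$, and $\|f\|_\Lambda=V_\Lambda(f)+|f(0)|$. For $m\ge 1$, $\Lambda_{(m)}=(\lambda_{m+1},\lambda_{m+2},\dots)$. A function $f\in\Lambda BV$ is continuous in $\Lambda$-variation if $\lim_{m\to\infty}V_{\Lambda_{(m)}}(f)=0$. $C\Lambda BV_c$ is the set of all continuous functions $f:[0,1]\to\mathbb{R}$ that are continuous in $\Lambda$-variation. The $n$-th Bernstein polynomial of $f$,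 viewed as a function on $[0,1]$, is $B_nf(x)=\sum_{k=0}^n f\left(\frac{k}{n}\right)\binom{n}{k}x^k(1-x)^{n-k}$, $n\ge1$. *)

theory Defs
  imports "HOL-Analysis.Analysis"
begin

(* Sequences are indexed from 0: "L k" stands for \<lambda>_(k+1). *)

definition Lambda_sequence :: "(nat \<Rightarrow> real) \<Rightarrow> bool" where
  "Lambda_sequence L \<longleftrightarrow>
     mono L \<and> (\<forall>k. 0 < L k) \<and> (\<Sum>k. ennreal (1 / L k)) = \<infinity>"

definition proper_Lambda_sequence :: "(nat \<Rightarrow> real) \<Rightarrow> bool" where
  "proper_Lambda_sequence L \<longleftrightarrow> Lambda_sequence L \<and> filterlim L at_top sequentially"

definition shift_Lambda :: "nat \<Rightarrow> (nat \<Rightarrow> real) \<Rightarrow> nat \<Rightarrow> real" where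
  "shift_Lambda m L = (\<lambda>k. L (k + m))"

(* The pair (a, b) encodes the interval {a..b}. *)

definition nonoverlapping :: "real \<times> real \<Rightarrow> real \<times> real \<Rightarrow> bool" where
  "nonoverlapping I J \<longleftrightarrow>
     {fst I..snd I} \<inter> {fst J..snd J} \<subseteq> {fst I, snd I} \<inter> {fst J, snd J}"

(* Degenerate intervals [a, a] and the empty list are allowed; neither affects the
   supremum defining the variation, since a degenerate interval contributes 0 and,
   L being nondecreasing, deleting it does not decrease the sum. *)

definition nonoverlapping_seqs :: "(real \<times> real) list set" where
  "nonoverlapping_seqs =
     {Is. (\<forall>I\<in>set Is. 0 \<le> fst I \<and> fst I \<le> snd I \<and> snd I \<le> 1) \<and>
          (\<forall>i<length Is. \<forall>j<length Is. i \<noteq> j \<longrightarrow> nonoverlapping (Is ! i) (Is ! j))}"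

definition Lambda_sum :: "(nat \<Rightarrow> real) \<Rightarrow> (real \<Rightarrow> real) \<Rightarrow> (real \<times> real) list \<Rightarrow> real" where
  "Lambda_sum L f Is = (\<Sum>k<length Is. \<bar>f (snd (Is ! k)) - f (fst (Is ! k))\<bar> / L k)"

(* A function on [0, 1] is represented by a total function; everything below depends
   only on its values on {0..1}. *)

definition Lambda_variation :: "(nat \<Rightarrow> real) \<Rightarrow> (real \<Rightarrow> real) \<Rightarrow> ennreal" where
  "Lambda_variation L f = (SUP Is\<in>nonoverlapping_seqs. ennreal (Lambda_sum L f Is))"

definition Lambda_BV :: "(nat \<Rightarrow> real) \<Rightarrow> (real \<Rightarrow> real) set" where
  "Lambda_BV L = {f. Lambda_variation L f < \<infinity>}"

(* Extended to all functions, with value \<infinity> outside Lambda_BV. *)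

definition Lambda_norm :: "(nat \<Rightarrow> real) \<Rightarrow> (real \<Rightarrow> real) \<Rightarrow> ennreal" where
  "Lambda_norm L f = Lambda_variation L f + ennreal \<bar>f 0\<bar>"

definition continuous_in_Lambda_variation :: "(nat \<Rightarrow> real) \<Rightarrow> (real \<Rightarrow> real) \<Rightarrow> bool" where
  "continuous_in_Lambda_variation L f \<longleftrightarrow>
     f \<in> Lambda_BV L \<and> (\<lambda>m. Lambda_variation (shift_Lambda m L) f) \<longlonglongrightarrow> 0"

definition C_Lambda_BV_c :: "(nat \<Rightarrow> real) \<Rightarrow> (real \<Rightarrow> real) set" where
  "C_Lambda_BV_c L = {f. continuous_on {0..1} f \<and> continuous_in_Lambda_variation L f}"

definition Bernstein_poly :: "nat \<Rightarrow> (real \<Rightarrow> real) \<Rightarrow> real \<Rightarrow> real" where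
  "Bernstein_poly n f x = (\<Sum>k\<le>n. f (real k / real n) * Bernstein n k x)"

end

theory Submission
  imports Defs
begin

text \<open>
  If \<open>B\<^sub>n f\<close> converges to \<open>f\<close> in norm, it converges uniformly, because the one-interval sums
  already control the sup norm; so \<open>f\<close> is continuous. A polynomial is Lipschitz on the unit
  interval, hence its variation with respect to \<open>shift_Lambda m L\<close> is at most a constant over
  \<open>L m\<close>, which tends to zero as \<open>L\<close> is proper. Since the variation of \<open>f - B\<^sub>n f\<close> only decreases
  under shifts, \<open>f\<close> inherits continuity in variation from \<open>B\<^sub>n f\<close>
  (lemma \<open>continuous_in_Lambda_variation_if_Bernstein_tendsto\<close>).

  Conversely, the point is that Bernstein operators do not increase the variation, for any
  weights (lemma \<open>Lambda_variation_Bernstein_poly_le\<close>). This is a coupling argument. Let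
  \<open>U\<^sub>1, \<dots>, U\<^sub>n\<close> be independent and uniform on the unit interval and let \<open>X x\<close> be the number of \<open>i\<close>
  with \<open>U\<^sub>i \<le> x\<close>. Then \<open>B\<^sub>n f x\<close> is the expectation of \<open>f (X x / n)\<close>, and for every outcome the map
  \<open>x \<mapsto> X x / n\<close> is monotone, so it carries nonoverlapping intervals to nonoverlapping intervals.
  The weighted sum for \<open>B\<^sub>n f\<close> is thus at most an average of weighted sums for \<open>f\<close>. Now split a
  sum for \<open>B\<^sub>n f - f\<close> after its first \<open>m\<close> terms (lemma \<open>Lambda_variation_le_sup_plus_tail\<close>). The
  rest is at most twice the variation of \<open>f\<close> for the weights \<open>shift_Lambda m L\<close>, uniformly in \<open>n\<close>,
  and small for large \<open>m\<close>; with \<open>m\<close> chosen, the first \<open>m\<close> terms are small for large \<open>n\<close> by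
  Bernstein's approximation theorem.
\<close>

section \<open>Nonoverlapping intervals\<close>

lemma nonoverlapping_iff:
  assumes "fst I \<le> snd I" "fst J \<le> snd J"
  shows "nonoverlapping I J \<longleftrightarrow> snd I \<le> fst J \<or> snd J \<le> fst I"
proof
  assume no: "nonoverlapping I J"
  show "snd I \<le> fst J \<or> snd J \<le> fst I"
  proof (rule ccontr)
    assume "\<not> ?thesis"
    then have lt: "fst J < snd I" "fst I < snd J" by auto
    \<comment> \<open>The midpoint of the intersection is interior to at least one of the two intervals.\<close>
    define p where "p = max (fst I) (fst J)"
    define q where "q = min (snd I) (snd J)"
    have "p \<le> q" using assms lt by (auto simp: p_def q_def)
    then have "(p + q) / 2 \<in> {fst I..snd I} \<inter> {fst J..snd J}"
      by (auto simp: p_def q_def)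
    then have "(p + q) / 2 \<in> {fst I, snd I} \<inter> {fst J, snd J}"
      using no unfolding nonoverlapping_def by blast
    then show False
      using assms lt by (auto simp: p_def q_def max_def min_def split: if_splits)
  qed
next
  assume "snd I \<le> fst J \<or> snd J \<le> fst I"
  then show "nonoverlapping I J"
    using assms by (auto simp: nonoverlapping_def)
qed

lemma nonoverlapping_seqsD:
  assumes "Is \<in> nonoverlapping_seqs" "i < length Is"
  shows "0 \<le> fst (Is ! i)" "fst (Is ! i) \<le> snd (Is ! i)" "snd (Is ! i) \<le> 1"
  using assms by (auto simp: nonoverlapping_seqs_def)

lemma nonoverlapping_seqs_separated:
  assumes "Is \<in> nonoverlapping_seqs" "i < length Is" "j < length Is" "i \<noteq> j"
  shows "snd (Is ! i) \<le> fst (Is ! j) \<or> snd (Is ! j) \<le> fst (Is ! i)"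
proof -
  have "nonoverlapping (Is ! i) (Is ! j)"
    using assms by (auto simp: nonoverlapping_seqs_def)
  then show ?thesis
    using nonoverlapping_seqsD(2)[OF assms(1)] assms(2,3) by (simp add: nonoverlapping_iff)
qed

lemma drop_nonoverlapping_seqs:
  assumes "Is \<in> nonoverlapping_seqs"
  shows "drop m Is \<in> nonoverlapping_seqs"
  using assms by (auto simp: nonoverlapping_seqs_def dest: in_set_dropD)

lemma nonoverlapping_seqs_map_mono:
  assumes Is: "Is \<in> nonoverlapping_seqs"
    and mono: "mono_on {0..1} r"
    and range: "\<And>x. x \<in> {0..1} \<Longrightarrow> r x \<in> {0..1}"
  shows "map (\<lambda>I. (r (fst I), r (snd I))) Is \<in> nonoverlapping_seqs"
proof -
  have le: "r x \<le> r y" if "0 \<le> x" "x \<le> y" "y \<le> 1" for x y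
    using that by (intro mono_onD[OF mono]) auto
  have r: "0 \<le> r (fst I) \<and> r (fst I) \<le> r (snd I) \<and> r (snd I) \<le> 1" if "I \<in> set Is" for I
  proof -
    have "0 \<le> fst I" "fst I \<le> snd I" "snd I \<le> 1"
      using Is that by (simp_all add: nonoverlapping_seqs_def)
    then show ?thesis
      using le[of "fst I" "snd I"] range[of "fst I"] range[of "snd I"] by simp
  qed
  have "nonoverlapping (r (fst (Is ! i)), r (snd (Is ! i))) (r (fst (Is ! j)), r (snd (Is ! j)))"
    if "i < length Is" "j < length Is" "i \<noteq> j" for i j
    using nonoverlapping_seqs_separated[OF Is that]
      nonoverlapping_seqsD[OF Is that(1)] nonoverlapping_seqsD[OF Is that(2)]
      r[OF nth_mem[OF that(1)]] r[OF nth_mem[OF that(2)]]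
      le[of "snd (Is ! i)" "fst (Is ! j)"] le[of "snd (Is ! j)" "fst (Is ! i)"]
    by (simp add: nonoverlapping_iff) linarith
  then show ?thesis
    unfolding nonoverlapping_seqs_def using r by simp
qed

lemma nonoverlapping_seqs_total_length:
  assumes Is: "Is \<in> nonoverlapping_seqs"
  shows "(\<Sum>k<length Is. snd (Is ! k) - fst (Is ! k)) \<le> 1"
proof -
  define A where "A k = {fst (Is ! k)<..<snd (Is ! k)}" for k
  note b = nonoverlapping_seqsD[OF Is]
  have disj: "disjoint_family_on A {..<length Is}"
    unfolding disjoint_family_on_def
  proof (intro ballI impI)
    fix i j assume "i \<in> {..<length Is}" "j \<in> {..<length Is}" "i \<noteq> j"
    then show "A i \<inter> A j = {}"
      using nonoverlapping_seqs_separated[OF Is, of i j] by (auto simp: A_def)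
  qed
  have "ennreal (\<Sum>k<length Is. snd (Is ! k) - fst (Is ! k)) = (\<Sum>k<length Is. emeasure lborel (A k))"
    using b by (subst sum_ennreal[symmetric]) (auto simp: A_def intro!: sum.cong)
  also have "\<dots> = emeasure lborel (\<Union>k<length Is. A k)"
    by (rule sum_emeasure[OF _ disj]) (auto simp: A_def)
  also have "\<dots> \<le> emeasure lborel {0..1::real}"
  proof (intro emeasure_mono UN_least)
    show "A k \<subseteq> {0..1}" if "k \<in> {..<length Is}" for k
      using b[of k] that by (auto simp: A_def)
  qed simp
  finally show ?thesis by simp
qed

section \<open>Elementary properties of the variation\<close>

lemma Lambda_variation_upper:
  "Is \<in> nonoverlapping_seqs \<Longrightarrow> ennreal (Lambda_sum L f Is) \<le> Lambda_variation L f"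
  unfolding Lambda_variation_def by (rule SUP_upper)

lemma Lambda_variation_least:
  "(\<And>Is. Is \<in> nonoverlapping_seqs \<Longrightarrow> ennreal (Lambda_sum L f Is) \<le> C) \<Longrightarrow> Lambda_variation L f \<le> C"
  unfolding Lambda_variation_def by (rule SUP_least)

lemma Lambda_sum_nonneg:
  assumes "\<And>k. 0 < L k"
  shows "0 \<le> Lambda_sum L f Is"
  unfolding Lambda_sum_def using assms by (intro sum_nonneg divide_nonneg_pos) auto

lemma Lambda_variation_diff_le:
  assumes pos: "\<And>k. 0 < L k"
  shows "Lambda_variation L (\<lambda>x. f x - g x) \<le> Lambda_variation L f + Lambda_variation L g"
proof (rule Lambda_variation_least)
  fix Is assume Is: "Is \<in> nonoverlapping_seqs"
  have "Lambda_sum L (\<lambda>x. f x - g x) Is \<le> Lambda_sum L f Is + Lambda_sum L g Is"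
    unfolding Lambda_sum_def sum.distrib[symmetric] add_divide_distrib[symmetric]
    using pos by (intro sum_mono divide_right_mono) (auto intro: less_imp_le)
  then have "ennreal (Lambda_sum L (\<lambda>x. f x - g x) Is)
      \<le> ennreal (Lambda_sum L f Is) + ennreal (Lambda_sum L g Is)"
    using Lambda_sum_nonneg[of L, OF pos] by (simp add: ennreal_plus[symmetric] del: ennreal_plus)
  also have "\<dots> \<le> Lambda_variation L f + Lambda_variation L g"
    by (intro add_mono Lambda_variation_upper Is)
  finally show "ennreal (Lambda_sum L (\<lambda>x. f x - g x) Is)
      \<le> Lambda_variation L f + Lambda_variation L g" .
qed

lemma Lambda_variation_shift_le:
  assumes "mono L" and pos: "\<And>k. 0 < L k"
  shows "Lambda_variation (shift_Lambda m L) f \<le> Lambda_variation L f"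
proof (rule Lambda_variation_least)
  fix Is assume Is: "Is \<in> nonoverlapping_seqs"
  have "Lambda_sum (shift_Lambda m L) f Is \<le> Lambda_sum L f Is"
    unfolding Lambda_sum_def shift_Lambda_def
    using pos monoD[OF \<open>mono L\<close>] by (intro sum_mono divide_left_mono) auto
  then show "ennreal (Lambda_sum (shift_Lambda m L) f Is) \<le> Lambda_variation L f"
    using Lambda_variation_upper[OF Is] order_trans ennreal_leI by blast
qed

lemma sum_lessThan_add:
  fixes t :: "nat \<Rightarrow> 'a::comm_monoid_add"
  shows "sum t {..<m + d} = sum t {..<m} + (\<Sum>k<d. t (k + m))"
  by (induction d) (simp_all add: add.assoc add.commute[of m])

lemma Lambda_sum_split:
  assumes "m \<le> length Is"
  shows "Lambda_sum L h Is = (\<Sum>k<m. \<bar>h (snd (Is ! k)) - h (fst (Is ! k))\<bar> / L k)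
           + Lambda_sum (shift_Lambda m L) h (drop m Is)"
proof -
  define t where "t k = \<bar>h (snd (Is ! k)) - h (fst (Is ! k))\<bar> / L k" for k
  have "Lambda_sum L h Is = sum t {..<m + (length Is - m)}"
    using assms by (simp add: Lambda_sum_def t_def)
  also have "\<dots> = sum t {..<m} + (\<Sum>k<length Is - m. t (k + m))"
    by (rule sum_lessThan_add)
  finally show ?thesis
    using assms by (simp add: Lambda_sum_def shift_Lambda_def t_def add.commute[of _ m])
qed

text \<open>
  Only boundedly many intervals see the large weights \<open>1 / L k\<close> with \<open>k < m\<close>; on these the
  increments are bounded by the sup norm.
\<close>

lemma Lambda_variation_le_sup_plus_tail:
  assumes "mono L" and pos: "\<And>k. 0 < L k"
    and s: "\<And>x. x \<in> {0..1} \<Longrightarrow> \<bar>h x\<bar> \<le> s"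
  shows "Lambda_variation L h
           \<le> ennreal (2 * real m * s / L 0) + Lambda_variation (shift_Lambda m L) h"
proof (rule Lambda_variation_least)
  fix Is assume Is: "Is \<in> nonoverlapping_seqs"
  have s0: "0 \<le> s" using s[of 0] by auto
  define l where "l = min m (length Is)"
  have "(\<Sum>k<l. \<bar>h (snd (Is ! k)) - h (fst (Is ! k))\<bar> / L k) \<le> (\<Sum>k<l. 2 * s / L 0)"
  proof (rule sum_mono)
    fix k assume "k \<in> {..<l}"
    then have k: "k < length Is" by (simp add: l_def)
    have "\<bar>h (snd (Is ! k))\<bar> \<le> s" "\<bar>h (fst (Is ! k))\<bar> \<le> s"
      using nonoverlapping_seqsD[OF Is k] by (intro s; simp)+
    then have "\<bar>h (snd (Is ! k)) - h (fst (Is ! k))\<bar> \<le> 2 * s" by linarith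
    then show "\<bar>h (snd (Is ! k)) - h (fst (Is ! k))\<bar> / L k \<le> 2 * s / L 0"
      using pos monoD[OF \<open>mono L\<close>, of 0 k] s0 by (intro frac_le) auto
  qed
  also have "\<dots> \<le> 2 * real m * s / L 0"
    using pos[of 0] s0 by (simp add: l_def divide_right_mono mult_right_mono)
  finally have head: "(\<Sum>k<l. \<bar>h (snd (Is ! k)) - h (fst (Is ! k))\<bar> / L k) \<le> 2 * real m * s / L 0" .
  have "drop l Is = drop m Is" by (auto simp: l_def min_def)
  moreover have "Lambda_sum (shift_Lambda l L) h (drop m Is) = Lambda_sum (shift_Lambda m L) h (drop m Is)"
    by (cases "m \<le> length Is") (auto simp: l_def Lambda_sum_def)
  ultimately have "Lambda_sum L h Is \<le> 2 * real m * s / L 0 + Lambda_sum (shift_Lambda m L) h (drop m Is)"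
    using Lambda_sum_split[of l Is L h] head by (simp add: l_def)
  moreover have "0 \<le> Lambda_sum (shift_Lambda m L) h (drop m Is)"
    by (rule Lambda_sum_nonneg) (simp add: shift_Lambda_def pos)
  moreover have "0 \<le> 2 * real m * s / L 0" using s0 pos[of 0] by simp
  ultimately have "ennreal (Lambda_sum L h Is)
      \<le> ennreal (2 * real m * s / L 0) + ennreal (Lambda_sum (shift_Lambda m L) h (drop m Is))"
    by (simp add: ennreal_plus[symmetric] del: ennreal_plus)
  also have "\<dots> \<le> ennreal (2 * real m * s / L 0) + Lambda_variation (shift_Lambda m L) h"
    by (intro add_left_mono Lambda_variation_upper drop_nonoverlapping_seqs Is)
  finally show "ennreal (Lambda_sum L h Is)
      \<le> ennreal (2 * real m * s / L 0) + Lambda_variation (shift_Lambda m L) h" .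
qed

text \<open>The norm dominates the sup norm: test the variation on the single interval from \<open>0\<close> to \<open>x\<close>.\<close>

lemma abs_le_Lambda_norm:
  assumes pos: "0 < L 0" and x: "x \<in> {0..1}"
  shows "ennreal \<bar>h x\<bar> \<le> ennreal (1 + L 0) * Lambda_norm L h"
proof -
  have "[(0, x)] \<in> nonoverlapping_seqs"
    using x by (auto simp: nonoverlapping_seqs_def)
  from Lambda_variation_upper[OF this, of L h]
  have v: "ennreal (\<bar>h x - h 0\<bar> / L 0) \<le> Lambda_variation L h"
    by (simp add: Lambda_sum_def)
  have "\<bar>h x\<bar> \<le> L 0 * (\<bar>h x - h 0\<bar> / L 0) + \<bar>h 0\<bar>" using pos by simp
  then have "ennreal \<bar>h x\<bar> \<le> ennreal (L 0 * (\<bar>h x - h 0\<bar> / L 0) + \<bar>h 0\<bar>)"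
    by (rule ennreal_leI)
  also have "\<dots> = ennreal (L 0) * ennreal (\<bar>h x - h 0\<bar> / L 0) + 1 * ennreal \<bar>h 0\<bar>"
    using pos by (subst ennreal_plus) (auto simp: ennreal_mult[symmetric])
  also have "\<dots> \<le> ennreal (1 + L 0) * Lambda_variation L h + ennreal (1 + L 0) * ennreal \<bar>h 0\<bar>"
    using pos by (intro add_mono mult_mono v ennreal_leI) (auto simp: ennreal_1[symmetric] simp del: ennreal_1)
  finally show ?thesis by (simp add: Lambda_norm_def distrib_left)
qed

text \<open>Bound every weight by the largest one, \<open>1 / L 0\<close>, and add up the lengths of the intervals.\<close>

lemma Lambda_variation_lipschitz_le:
  assumes "mono L" and pos: "\<And>k. 0 < L k"
    and "0 \<le> C" and lip: "\<And>x y. x \<in> {0..1} \<Longrightarrow> y \<in> {0..1} \<Longrightarrow> \<bar>g y - g x\<bar> \<le> C * \<bar>y - x\<bar>"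
  shows "Lambda_variation L g \<le> ennreal (C / L 0)"
proof (rule Lambda_variation_least)
  fix Is assume Is: "Is \<in> nonoverlapping_seqs"
  have "Lambda_sum L g Is \<le> (\<Sum>k<length Is. (C / L 0) * (snd (Is ! k) - fst (Is ! k)))"
    unfolding Lambda_sum_def
  proof (rule sum_mono)
    fix k assume "k \<in> {..<length Is}"
    then have b: "0 \<le> fst (Is ! k)" "fst (Is ! k) \<le> snd (Is ! k)" "snd (Is ! k) \<le> 1"
      using nonoverlapping_seqsD[OF Is] by auto
    then have "\<bar>g (snd (Is ! k)) - g (fst (Is ! k))\<bar> \<le> C * (snd (Is ! k) - fst (Is ! k))"
      using lip[of "fst (Is ! k)" "snd (Is ! k)"] by simp
    then have "\<bar>g (snd (Is ! k)) - g (fst (Is ! k))\<bar> / L k \<le> C * (snd (Is ! k) - fst (Is ! k)) / L 0"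
      using pos monoD[OF \<open>mono L\<close>, of 0 k] b \<open>0 \<le> C\<close> by (intro frac_le) auto
    then show "\<bar>g (snd (Is ! k)) - g (fst (Is ! k))\<bar> / L k \<le> (C / L 0) * (snd (Is ! k) - fst (Is ! k))"
      by simp
  qed
  also have "\<dots> = (C / L 0) * (\<Sum>k<length Is. snd (Is ! k) - fst (Is ! k))"
    by (simp add: sum_distrib_left)
  also have "\<dots> \<le> (C / L 0) * 1"
    using nonoverlapping_seqs_total_length[OF Is] \<open>0 \<le> C\<close> pos[of 0] by (intro mult_left_mono) auto
  finally show "ennreal (Lambda_sum L g Is) \<le> ennreal (C / L 0)" by (simp add: ennreal_leI)
qed

section \<open>Bernstein polynomials do not increase the variation\<close>

text \<open>Condition on the outcome of one of the \<open>n + 1\<close> Bernoulli trials.\<close>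

lemma Bernstein_sum_Suc:
  "(\<Sum>k\<le>Suc n. g k * Bernstein (Suc n) k x)
     = x * (\<Sum>k\<le>n. g (Suc k) * Bernstein n k x) + (1 - x) * (\<Sum>k\<le>n. g k * Bernstein n k x)"
proof -
  \<comment> \<open>Pascal's rule; the extra term for \<open>k = n\<close> vanishes with the binomial coefficient.\<close>
  have S: "Bernstein (Suc n) (Suc k) x
      = x * Bernstein n k x + (1 - x) * (if k < n then Bernstein n (Suc k) x else 0)" if "k \<le> n" for k
  proof (cases "k < n")
    case True
    then have pow: "(1 - x) ^ (n - k) = (1 - x) * (1 - x) ^ (n - Suc k)"
      by (metis Suc_diff_Suc power_Suc)
    show ?thesis
      unfolding Bernstein_def diff_Suc_Suc pow using True by (simp add: algebra_simps)
  next
    case False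
    then show ?thesis using that by (simp add: Bernstein_def)
  qed
  have "(\<Sum>k\<le>Suc n. g k * Bernstein (Suc n) k x)
      = g 0 * Bernstein (Suc n) 0 x + (\<Sum>k\<le>n. g (Suc k) * Bernstein (Suc n) (Suc k) x)"
    by (rule sum.atMost_Suc_shift)
  also have "(\<Sum>k\<le>n. g (Suc k) * Bernstein (Suc n) (Suc k) x)
      = x * (\<Sum>k\<le>n. g (Suc k) * Bernstein n k x)
        + (1 - x) * (\<Sum>k\<le>n. g (Suc k) * (if k < n then Bernstein n (Suc k) x else 0))"
    unfolding sum_distrib_left sum.distrib[symmetric]
    by (intro sum.cong refl) (simp only: S atMost_iff, simp add: algebra_simps)
  also have "(\<Sum>k\<le>n. g (Suc k) * (if k < n then Bernstein n (Suc k) x else 0))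
      = (\<Sum>k<n. g (Suc k) * Bernstein n (Suc k) x)"
    by (intro sum.mono_neutral_cong_right) auto
  also have "g 0 * Bernstein (Suc n) 0 x = (1 - x) * (g 0 * Bernstein n 0 x)"
    by (simp add: Bernstein_def)
  also have "(1 - x) * (g 0 * Bernstein n 0 x) + (x * (\<Sum>k\<le>n. g (Suc k) * Bernstein n k x)
      + (1 - x) * (\<Sum>k<n. g (Suc k) * Bernstein n (Suc k) x))
      = x * (\<Sum>k\<le>n. g (Suc k) * Bernstein n k x)
        + (1 - x) * (g 0 * Bernstein n 0 x + (\<Sum>k<n. g (Suc k) * Bernstein n (Suc k) x))"
    by (simp add: algebra_simps)
  also have "g 0 * Bernstein n 0 x + (\<Sum>k<n. g (Suc k) * Bernstein n (Suc k) x)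
      = (\<Sum>k\<le>n. g k * Bernstein n k x)"
    by (rule sum.atMost_shift[symmetric])
  finally show ?thesis .
qed

text \<open>
  The coupling, with the uniform variables integrated out one at a time. Here \<open>c x\<close> is the number
  of variables at most \<open>x\<close> among the \<open>N - n\<close> ones already fixed, and the Bernstein sum is the
  conditional expectation over the remaining \<open>n\<close>. Fixing one more variable \<open>u\<close> replaces \<open>c\<close> by
  \<open>\<lambda>x. c x + (if u \<le> x then 1 else 0)\<close>, which is again monotone; when none remains, the
  intervals are mapped by the monotone function \<open>x \<mapsto> c x / N\<close>.
\<close>

lemma Lambda_sum_Bernstein_coupling:
  fixes c :: "real \<Rightarrow> nat"
  assumes Is: "Is \<in> nonoverlapping_seqs" and pos: "\<And>k. 0 < L k"
    and V: "\<And>Js. Js \<in> nonoverlapping_seqs \<Longrightarrow> Lambda_sum L f Js \<le> V"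
    and c: "mono_on {0..1} c" "\<And>x. x \<in> {0..1} \<Longrightarrow> c x + n \<le> N"
  shows "Lambda_sum L (\<lambda>x. \<Sum>j\<le>n. f (real (c x + j) / real N) * Bernstein n j x) Is \<le> V"
  using c
proof (induction n arbitrary: c)
  case 0
  define r where "r x = real (c x) / real N" for x
  have "map (\<lambda>I. (r (fst I), r (snd I))) Is \<in> nonoverlapping_seqs"
  proof (rule nonoverlapping_seqs_map_mono[OF Is])
    show "mono_on {0..1} r"
      using 0(1) unfolding r_def by (auto simp: mono_on_def divide_right_mono)
    show "r x \<in> {0..1}" if "x \<in> {0..1}" for x
      using 0(2)[OF that] by (auto simp: r_def divide_le_eq_1)
  qed
  from V[OF this] show ?case
    by (simp add: Lambda_sum_def r_def Bernstein_def)
next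
  case (Suc n)
  define e where "e u x = (if u \<le> x then 1 else 0 :: nat)" for u x :: real
  define F where "F d x = (\<Sum>j\<le>n. f (real (c x + d + j) / real N) * Bernstein n j x)" for d x
  define G where "G x = (\<Sum>j\<le>Suc n. f (real (c x + j) / real N) * Bernstein (Suc n) j x)" for x
  have G: "G x = x * F 1 x + (1 - x) * F 0 x" for x
    unfolding G_def F_def Bernstein_sum_Suc by simp
  have int: "((\<lambda>u. F (e u x) x) has_integral G x) {0..1}" if "x \<in> {0..1}" for x
  proof -
    have "((\<lambda>u. F 1 x) has_integral (x * F 1 x)) {0..x}"
      using has_integral_const_real[of "F 1 x" 0 x] that by simp
    then have 1: "((\<lambda>u. F (e u x) x) has_integral (x * F 1 x)) {0..x}"
      by (rule has_integral_eq[rotated]) (simp add: e_def)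
    have "((\<lambda>u. F 0 x) has_integral ((1 - x) * F 0 x)) {x..1}"
      using has_integral_const_real[of "F 0 x" x 1] that by simp
    then have 2: "((\<lambda>u. F (e u x) x) has_integral ((1 - x) * F 0 x)) {x..1}"
      by (rule has_integral_spike_finite[of "{x}", rotated 2]) (auto simp: e_def)
    show ?thesis
      unfolding G using that by (intro has_integral_combine[OF _ _ 1 2]) auto
  qed
  \<comment> \<open>Fixing the signs of the increments of \<open>G\<close> makes the weighted sum linear, so that it
     commutes with the integral over \<open>u\<close>.\<close>
  define s where "s k = sgn (G (snd (Is ! k)) - G (fst (Is ! k))) / L k" for k
  have lhs: "((\<lambda>u. \<Sum>k<length Is. s k * (F (e u (snd (Is ! k))) (snd (Is ! k))
            - F (e u (fst (Is ! k))) (fst (Is ! k))))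
      has_integral (\<Sum>k<length Is. s k * (G (snd (Is ! k)) - G (fst (Is ! k))))) {0..1}"
  proof (rule has_integral_sum[OF finite_lessThan])
    fix k assume "k \<in> {..<length Is}"
    then have "snd (Is ! k) \<in> {0..1}" "fst (Is ! k) \<in> {0..1}"
      using nonoverlapping_seqsD[OF Is, of k] by auto
    then show "((\<lambda>u. s k * (F (e u (snd (Is ! k))) (snd (Is ! k)) - F (e u (fst (Is ! k))) (fst (Is ! k))))
        has_integral s k * (G (snd (Is ! k)) - G (fst (Is ! k)))) {0..1}"
      by (intro has_integral_mult_right has_integral_diff int)
  qed
  have le_V: "(\<Sum>k<length Is. s k * (F (e u (snd (Is ! k))) (snd (Is ! k))
            - F (e u (fst (Is ! k))) (fst (Is ! k)))) \<le> V" for u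
  proof -
    have "mono_on {0..1} (\<lambda>x. c x + e u x)"
      using Suc.prems(1) by (auto simp: mono_on_def e_def add_mono le_SucI)
    moreover have "c x + e u x + n \<le> N" if "x \<in> {0..1}" for x
      using Suc.prems(2)[OF that] by (simp add: e_def)
    ultimately have IH: "Lambda_sum L (\<lambda>x. F (e u x) x) Is \<le> V"
      unfolding F_def by (rule Suc.IH)
    have "sgn p * q / L k \<le> \<bar>q\<bar> / L k" for p q :: real and k
      using pos[of k] by (intro divide_right_mono) (auto simp: sgn_real_def)
    then have sgn_le: "sgn p / L k * q \<le> \<bar>q\<bar> / L k" for p q :: real and k
      by simp
    have "(\<Sum>k<length Is. s k * (F (e u (snd (Is ! k))) (snd (Is ! k))
            - F (e u (fst (Is ! k))) (fst (Is ! k)))) \<le> Lambda_sum L (\<lambda>x. F (e u x) x) Is"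
      unfolding Lambda_sum_def s_def by (intro sum_mono sgn_le)
    then show ?thesis using IH by linarith
  qed
  have "((\<lambda>u. V) has_integral V) {0..1::real}"
    using has_integral_const_real[of V 0 1] by simp
  from has_integral_le[OF lhs this le_V]
  have "(\<Sum>k<length Is. s k * (G (snd (Is ! k)) - G (fst (Is ! k)))) \<le> V" .
  moreover have "sgn p / l * p = \<bar>p\<bar> / l" for p l :: real
    by (simp add: sgn_real_def)
  ultimately have "Lambda_sum L G Is \<le> V"
    unfolding Lambda_sum_def s_def by (simp only:)
  then show ?case unfolding G_def .
qed

lemma Lambda_variation_Bernstein_poly_le:
  assumes pos: "\<And>k. 0 < L k"
  shows "Lambda_variation L (Bernstein_poly n f) \<le> Lambda_variation L f"
proof (cases "Lambda_variation L f")
  case (real V)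
  have "Lambda_sum L f Js \<le> V" if "Js \<in> nonoverlapping_seqs" for Js
    using Lambda_variation_upper[OF that, of L f] real by simp
  then have "Lambda_sum L (Bernstein_poly n f) Is \<le> V" if "Is \<in> nonoverlapping_seqs" for Is
    using Lambda_sum_Bernstein_coupling[of Is L f V "\<lambda>_. 0" n n, OF that pos]
    by (simp add: Bernstein_poly_def[abs_def] mono_on_def)
  then show ?thesis
    unfolding real by (intro Lambda_variation_least ennreal_leI)
qed simp

section \<open>Convergence in norm\<close>

lemma real_polynomial_function_Bernstein_poly:
  "real_polynomial_function (Bernstein_poly n f)"
  unfolding Bernstein_poly_def[abs_def] Bernstein_def
  by (intro real_polynomial_function_sum finite_atMost real_polynomial_function.intros
      real_polynomial_function_power real_polynomial_function_diff bounded_linear_ident)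

lemma Bernstein_poly_lipschitz:
  obtains C where "0 \<le> C"
    "\<And>x y. x \<in> {0..1} \<Longrightarrow> y \<in> {0..1} \<Longrightarrow> \<bar>Bernstein_poly n f y - Bernstein_poly n f x\<bar> \<le> C * \<bar>y - x\<bar>"
proof -
  obtain p' where p': "real_polynomial_function p'"
      and der: "\<And>x. (Bernstein_poly n f has_real_derivative p' x) (at x)"
    using has_real_derivative_polynomial_function[OF real_polynomial_function_Bernstein_poly] by blast
  have "continuous_on {0..1} p'"
    using p' by (intro continuous_on_polymonial_function) (simp add: real_polynomial_function_eq)
  then have "bounded (p' ` {0..1})"
    by (intro compact_imp_bounded compact_continuous_image) auto
  then obtain C where C: "0 < C" "\<And>x. x \<in> {0..1} \<Longrightarrow> \<bar>p' x\<bar> \<le> C"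
    by (auto simp: bounded_pos)
  show ?thesis
  proof
    show "0 \<le> C" using C by simp
    show "\<bar>Bernstein_poly n f y - Bernstein_poly n f x\<bar> \<le> C * \<bar>y - x\<bar>"
      if "x \<in> {0..1}" "y \<in> {0..1}" for x y
      using that C(2)
      by (intro field_differentiable_bound[of "{0..1}" _ p', unfolded real_norm_def]
          has_field_derivative_at_within[OF der]) auto
  qed
qed

lemma ennreal_tendsto_0I:
  fixes g :: "'a \<Rightarrow> ennreal"
  assumes "\<And>e. 0 < e \<Longrightarrow> \<forall>\<^sub>F x in F. g x \<le> ennreal e"
  shows "(g \<longlongrightarrow> 0) F"
proof (rule order_tendstoI)
  fix a :: ennreal assume "0 < a"
  then obtain b where b: "0 < b" "b < a" using dense by blast
  then obtain e where e: "b = ennreal e" "0 < e" by (cases b) auto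
  show "\<forall>\<^sub>F x in F. g x < a"
    using assms[OF e(2)] by eventually_elim (use b e in auto)
qed simp

lemma ennreal_tendsto_0D:
  fixes g :: "'a \<Rightarrow> ennreal"
  assumes "(g \<longlongrightarrow> 0) F" "0 < e"
  shows "\<forall>\<^sub>F x in F. g x \<le> ennreal e"
  using order_tendstoD(2)[OF assms(1), of "ennreal e"] assms(2) by (auto elim: eventually_mono)

lemma continuous_on_if_Bernstein_tendsto:
  assumes pos: "0 < L 0"
    and lim: "(\<lambda>n. Lambda_norm L (\<lambda>x. Bernstein_poly n f x - f x)) \<longlonglongrightarrow> 0"
  shows "continuous_on {0..1} f"
proof (rule uniform_limit_theorem)
  show "\<forall>\<^sub>F n in sequentially. continuous_on {0..1} (Bernstein_poly n f)"
    using real_polynomial_function_Bernstein_poly[of _ f]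
    by (intro always_eventually allI continuous_on_polymonial_function)
      (simp add: real_polynomial_function_eq)
  show "uniform_limit {0..1} (\<lambda>n. Bernstein_poly n f) f sequentially"
  proof (rule uniform_limitI)
    fix e :: real assume e: "0 < e"
    define d where "d = e / 2 / (1 + L 0)"
    have eq: "(1 + L 0) * d = e / 2"
      using pos by (subst mult.commute, subst nonzero_eq_divide_eq[symmetric]) (simp_all add: d_def)
    have d: "0 < d" using e pos by (simp add: d_def)
    show "\<forall>\<^sub>F n in sequentially. \<forall>x\<in>{0..1}. dist (Bernstein_poly n f x) (f x) < e"
      using ennreal_tendsto_0D[OF lim d]
    proof eventually_elim
      case (elim n)
      show ?case
      proof
        fix x :: real assume x: "x \<in> {0..1}"
        have "ennreal \<bar>Bernstein_poly n f x - f x\<bar>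
            \<le> ennreal (1 + L 0) * Lambda_norm L (\<lambda>x. Bernstein_poly n f x - f x)"
          using abs_le_Lambda_norm[of L x "\<lambda>x. Bernstein_poly n f x - f x"] pos x by simp
        also have "\<dots> \<le> ennreal (1 + L 0) * ennreal d"
          by (intro mult_left_mono elim) simp
        also have "\<dots> = ennreal ((1 + L 0) * d)"
          using pos d by (simp add: ennreal_mult)
        finally have "\<bar>Bernstein_poly n f x - f x\<bar> \<le> (1 + L 0) * d"
          using pos d by (simp add: ennreal_le_iff)
        then show "dist (Bernstein_poly n f x) (f x) < e"
          using eq e by (simp add: dist_real_def)
      qed
    qed
  qed
qed simp

lemma continuous_in_Lambda_variation_if_Bernstein_tendsto:
  assumes "mono L" and pos: "\<And>k. 0 < L k" and top: "filterlim L at_top sequentially"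
    and lim: "(\<lambda>n. Lambda_norm L (\<lambda>x. Bernstein_poly n f x - f x)) \<longlonglongrightarrow> 0"
  shows "continuous_in_Lambda_variation L f"
proof -
  \<comment> \<open>An estimate uniform in \<open>m\<close> for a fixed degree; \<open>m = 0\<close> gives finiteness of the variation.\<close>
  have approx: "\<exists>C\<ge>0. \<forall>m. Lambda_variation (shift_Lambda m L) f \<le> ennreal (C / L m + e)"
    if e: "0 < e" for e
  proof -
    obtain n where n: "Lambda_norm L (\<lambda>x. Bernstein_poly n f x - f x) \<le> ennreal e"
      using eventually_happens'[OF _ ennreal_tendsto_0D[OF lim e]] by auto
    obtain C where C: "0 \<le> C" "\<And>x y. x \<in> {0..1} \<Longrightarrow> y \<in> {0..1} \<Longrightarrow>
        \<bar>Bernstein_poly n f y - Bernstein_poly n f x\<bar> \<le> C * \<bar>y - x\<bar>"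
      using Bernstein_poly_lipschitz by metis
    have "Lambda_variation (shift_Lambda m L) f \<le> ennreal (C / L m + e)" for m
    proof -
      have pos': "0 < shift_Lambda m L k" for k by (simp add: shift_Lambda_def pos)
      have mono': "mono (shift_Lambda m L)"
        using \<open>mono L\<close> by (simp add: mono_def shift_Lambda_def)
      have "Lambda_variation (shift_Lambda m L) f
          \<le> Lambda_variation (shift_Lambda m L) (Bernstein_poly n f)
            + Lambda_variation (shift_Lambda m L) (\<lambda>x. Bernstein_poly n f x - f x)"
        using Lambda_variation_diff_le[of "shift_Lambda m L" "Bernstein_poly n f"
            "\<lambda>x. Bernstein_poly n f x - f x", OF pos'] by simp
      also have "Lambda_variation (shift_Lambda m L) (Bernstein_poly n f) \<le> ennreal (C / L m)"
        using Lambda_variation_lipschitz_le[OF mono' pos' C] by (simp add: shift_Lambda_def)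
      also have "Lambda_variation (shift_Lambda m L) (\<lambda>x. Bernstein_poly n f x - f x)
          \<le> Lambda_variation L (\<lambda>x. Bernstein_poly n f x - f x)"
        by (rule Lambda_variation_shift_le[OF \<open>mono L\<close> pos])
      also have "\<dots> \<le> Lambda_norm L (\<lambda>x. Bernstein_poly n f x - f x)"
        by (simp add: Lambda_norm_def)
      also note n
      finally show ?thesis
        using C(1) e pos[of m] by (simp add: ennreal_plus[symmetric] del: ennreal_plus)
    qed
    then show ?thesis using C(1) by blast
  qed
  have "Lambda_variation L f < \<infinity>"
  proof -
    obtain C where "Lambda_variation (shift_Lambda 0 L) f \<le> ennreal (C / L 0 + 1)"
      using approx[of 1] by auto
    then show ?thesis by (simp add: shift_Lambda_def le_less_trans)
  qed
  moreover have "(\<lambda>m. Lambda_variation (shift_Lambda m L) f) \<longlonglongrightarrow> 0"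
  proof (rule ennreal_tendsto_0I)
    fix e :: real assume e: "0 < e"
    obtain C where C: "0 \<le> C" "\<And>m. Lambda_variation (shift_Lambda m L) f \<le> ennreal (C / L m + e / 2)"
      using approx[of "e / 2"] e by auto
    have "\<forall>\<^sub>F m in sequentially. 2 * C / e \<le> L m"
      using top by (simp add: filterlim_at_top)
    then show "\<forall>\<^sub>F m in sequentially. Lambda_variation (shift_Lambda m L) f \<le> ennreal e"
    proof eventually_elim
      case (elim m)
      then have "C / L m + e / 2 \<le> e"
        using e pos[of m] by (simp add: field_simps)
      then show ?case using C(2)[of m] ennreal_leI order_trans by blast
    qed
  qed
  ultimately show ?thesis
    by (simp add: continuous_in_Lambda_variation_def Lambda_BV_def)
qed

lemma Lambda_norm_Bernstein_tendsto:
  assumes "mono L" and pos: "\<And>k. 0 < L k"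
    and cont: "continuous_on {0..1} f"
    and tail: "(\<lambda>m. Lambda_variation (shift_Lambda m L) f) \<longlonglongrightarrow> 0"
  shows "(\<lambda>n. Lambda_norm L (\<lambda>x. Bernstein_poly n f x - f x)) \<longlonglongrightarrow> 0"
proof (rule ennreal_tendsto_0I)
  fix e :: real assume e: "0 < e"
  obtain m where m: "Lambda_variation (shift_Lambda m L) f \<le> ennreal (e / 4)"
    using eventually_happens'[OF _ ennreal_tendsto_0D[OF tail, of "e / 4"]] e by auto
  \<comment> \<open>\<open>s\<close> bounds the uniform error: the first \<open>m\<close> intervals and the value at \<open>0\<close> may together
     use up half of \<open>e\<close>, the tail the other half.\<close>
  define D where "D = 2 * real m / L 0 + 1"
  define s where "s = e / 2 / D"
  have D: "0 < D" using pos[of 0] by (simp add: D_def add_nonneg_pos)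
  then have s: "0 < s" "D * s = e / 2" using e by (simp_all add: s_def)
  then have se: "2 * real m * s / L 0 + s = e / 2" by (simp add: D_def algebra_simps)
  obtain N where "\<forall>n x. N \<le> n \<and> x \<in> {0..1} \<longrightarrow> \<bar>f x - Bernstein_poly n f x\<bar> < s"
    using Bernstein_Weierstrass[OF cont s(1)] unfolding Bernstein_poly_def by blast
  then have N: "\<bar>Bernstein_poly n f x - f x\<bar> < s" if "N \<le> n" "x \<in> {0..1}" for n x
    using that by (simp add: abs_minus_commute)
  have pos': "0 < shift_Lambda m L k" for k by (simp add: shift_Lambda_def pos)
  show "\<forall>\<^sub>F n in sequentially. Lambda_norm L (\<lambda>x. Bernstein_poly n f x - f x) \<le> ennreal e"
    using eventually_ge_at_top[of N]
  proof eventually_elim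
    case (elim n)
    let ?h = "\<lambda>x. Bernstein_poly n f x - f x"
    have "Lambda_variation (shift_Lambda m L) ?h
        \<le> Lambda_variation (shift_Lambda m L) (Bernstein_poly n f) + Lambda_variation (shift_Lambda m L) f"
      by (rule Lambda_variation_diff_le[OF pos'])
    also have "\<dots> \<le> ennreal (e / 4) + ennreal (e / 4)"
      using Lambda_variation_Bernstein_poly_le[of "shift_Lambda m L" n f, OF pos'] m
      by (intro add_mono) auto
    also have "\<dots> = ennreal (e / 2)"
      using e by (simp add: ennreal_plus[symmetric] del: ennreal_plus)
    finally have t: "Lambda_variation (shift_Lambda m L) ?h \<le> ennreal (e / 2)" .
    have "Lambda_variation L ?h \<le> ennreal (2 * real m * s / L 0) + Lambda_variation (shift_Lambda m L) ?h"
      by (rule Lambda_variation_le_sup_plus_tail[OF \<open>mono L\<close> pos]) (rule less_imp_le[OF N[OF elim]])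
    also note t
    finally have "Lambda_norm L ?h \<le> ennreal (2 * real m * s / L 0) + ennreal (e / 2) + ennreal s"
      unfolding Lambda_norm_def using N[OF elim, of 0] by (intro add_mono ennreal_leI) auto
    also have "\<dots> = ennreal (2 * real m * s / L 0 + s + e / 2)"
      using e s(1) pos[of 0] by (simp add: ennreal_plus[symmetric] add_ac del: ennreal_plus)
    finally show ?case using se by simp
  qed
qed

theorem theorem7:
  fixes L :: "nat \<Rightarrow> real" and f :: "real \<Rightarrow> real"
  assumes "proper_Lambda_sequence L"
  shows "((\<lambda>n. Lambda_norm L (\<lambda>x. Bernstein_poly n f x - f x)) \<longlonglongrightarrow> 0)
           \<longleftrightarrow> f \<in> C_Lambda_BV_c L"
proof -
  have L: "mono L" "\<And>k. 0 < L k" "filterlim L at_top sequentially"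
    using assms by (auto simp: proper_Lambda_sequence_def Lambda_sequence_def)
  show ?thesis
  proof
    assume lim: "(\<lambda>n. Lambda_norm L (\<lambda>x. Bernstein_poly n f x - f x)) \<longlonglongrightarrow> 0"
    show "f \<in> C_Lambda_BV_c L"
      using continuous_on_if_Bernstein_tendsto[OF L(2) lim]
        continuous_in_Lambda_variation_if_Bernstein_tendsto[OF L lim]
      by (simp add: C_Lambda_BV_c_def)
  next
    assume "f \<in> C_Lambda_BV_c L"
    then have "continuous_on {0..1} f" "(\<lambda>m. Lambda_variation (shift_Lambda m L) f) \<longlonglongrightarrow> 0"
      by (simp_all add: C_Lambda_BV_c_def continuous_in_Lambda_variation_def)
    then show "(\<lambda>n. Lambda_norm L (\<lambda>x. Bernstein_poly n f x - f x)) \<longlonglongrightarrow> 0"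
      by (rule Lambda_norm_Bernstein_tendsto[OF L(1,2)])
  qed
qed

end
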